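(* Let $\mathbb{X}, \mathbb{Y}, \mathbb{Z}$ be smooth real Banach spaces, each of dimension strictly greater than $1$, and let $\mathcal{T} \in \mathscr{B}(\mathbb{X} \times \mathbb{Y}, \mathbb{Z})$. Let $[\,\cdot,\cdot\,]_{\mathbb{X}}, [\,\cdot,\cdot\,]_{\mathbb{Y}}, [\,\cdot,\cdot\,]_{\mathbb{Z}}$ be the unique semi-inner-products (compatible with the norms) on $\mathbb{X}, \mathbb{Y}, \mathbb{Z}$ respectively. Let $(x_0,y_0) \in S_{\mathbb{X} \times \mathbb{Y}}$. Then $(x_0,y_0) \in M_{\mathcal{T}}$ if and only if the following two conditions hold: (i) $\|x_0\| = \|y_0\| = 1$; (ii) for every $x \in \mathbb{X}$ and every $y \in \mathbb{Y}$, \[ [\mathcal{T}(x_0,y) + \mathcal{T}(x,y_0), \mathcal{T}(x_0,y_0)]_{\mathbb{Z}} = \|\mathcal{T}\|^{2} \big([x,x_0]_{\mathbb{X}} + [y,y_0]_{\mathbb{Y}}\big). \]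
   Context: The product $\mathbb{X} \times \mathbb{Y}$ carries the norm $\|(x,y)\| = \max\{\|x\|,\|y\|\}$, and $S_{\mathbb{X} \times \mathbb{Y}}$ is its unit sphere. For a bilinear operator $\mathcal{T}: \mathbb{X} \times \mathbb{Y} \to \mathbb{Z}$ (linear in each argument), $\|\mathcal{T}\| = \sup\{\|\mathcal{T}(x,y)\| : (x,y) \in S_{\mathbb{X} \times \mathbb{Y}}\}$; $\mathcal{T}$ is bounded if $\|\mathcal{T}\|<\infty$. $\mathscr{B}(\mathbb{X} \times \mathbb{Y}, \mathbb{Z})$ is the Banach space of all bounded bilinear operators from $\mathbb{X} \times \mathbb{Y}$ to $\mathbb{Z}$ with this norm. The norm attainment set is $M_{\mathcal{T}} = \{(x,y) \in S_{\mathbb{X} \times \mathbb{Y}} : \|\mathcal{T}(x,y)\| = \|\mathcal{T}\|\}$. A Banach space $E$ is smooth if at every $u \in E$ with $\|u\|=1$ there is a unique supporting hyperplane to the closed unit ball of $E$. A semi-inner-product (s.i.p.) on a real normed space $E$ is a function $[\,\cdot,\cdot\,]: E \times E \to \mathbb{R}$ such that for all $\alpha,\beta \in \mathbb{R}$ and $x,y,z \in E$: (a) $[\alpha x + \beta y, z] = \alpha[x,z] + \beta[y,z]$; (b) $[x,x] > 0$ whenever $x \neq 0$; (c) $|[x,y]|^2 \leq [x,x][y,y]$; (d) $[x,\alpha y] = \alpha[x,y]$. It is compatible with the norm if $[x,x] = \|x\|^2$ for all $x \in E$; every s.i.p. is assumed compatible with the norm. On a smooth Banach space there is exactly one s.i.p.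 compatible with the norm.
   Formalization: The operator T is assumed to be nonzero; for T = 0 the claim fails, since then M_T is the whole unit sphere and contains (x_0, 0) with ‖x_0‖ = 1, which violates condition (i). *)

theory Defs
  imports "HOL-Analysis.Analysis"
begin

text \<open>
  The product norm is the maximum norm, whereas the library instance for \<open>'a \<times> 'b\<close> uses the
  Euclidean combination of the two norms; hence the explicit unit sphere.
\<close>

definition prod_sphere :: "('a::real_normed_vector \<times> 'b::real_normed_vector) set" where
  "prod_sphere = {(x, y). max (norm x) (norm y) = 1}"

definition bilinear_norm ::
    "('a::real_normed_vector \<Rightarrow> 'b::real_normed_vector \<Rightarrow> 'c::real_normed_vector) \<Rightarrow> real" where
  "bilinear_norm T = (SUP (x, y)\<in>prod_sphere. norm (T x y))"

definition norm_attainment_set ::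
    "('a::real_normed_vector \<Rightarrow> 'b::real_normed_vector \<Rightarrow> 'c::real_normed_vector) \<Rightarrow> ('a \<times> 'b) set" where
  "norm_attainment_set T = {(x, y) \<in> prod_sphere. norm (T x y) = bilinear_norm T}"

text \<open>
  The supremum above is a real number that is only meaningful for bounded operators. The next
  lemma shows that the library predicate \<^const>\<open>bounded_bilinear\<close> says exactly that \<open>T\<close> is
  bilinear and that this supremum is finite.
\<close>

lemma bounded_bilinear_iff_bdd_above_prod_sphere:
  fixes T :: "'a::real_normed_vector \<Rightarrow> 'b::real_normed_vector \<Rightarrow> 'c::real_normed_vector"
  shows "bounded_bilinear T \<longleftrightarrow>
    bilinear T \<and> bdd_above ((\<lambda>(x, y). norm (T x y)) ` prod_sphere)"
proof
  assume T: "bounded_bilinear T"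
  interpret bounded_bilinear T by (fact T)
  obtain K where K: "K \<ge> 0" "\<And>x y. norm (T x y) \<le> norm x * norm y * K"
    using nonneg_bounded by blast
  have "norm (T x y) \<le> K" if "(x, y) \<in> prod_sphere" for x y
  proof -
    have "norm x \<le> 1" "norm y \<le> 1" using that by (auto simp: prod_sphere_def)
    then have "norm x * norm y \<le> 1" by (simp add: mult_le_one)
    then have "norm x * norm y * K \<le> K" using K(1) mult_right_mono by fastforce
    with K(2)[of x y] show ?thesis by linarith
  qed
  then have "bdd_above ((\<lambda>(x, y). norm (T x y)) ` prod_sphere)"
    by (intro bdd_aboveI2[where M = K]) auto
  moreover have "bilinear T"
    by (auto simp: bilinear_def intro!: linearI simp: add_left add_right scaleR_left scaleR_right)
  ultimately show "bilinear T \<and> bdd_above ((\<lambda>(x, y). norm (T x y)) ` prod_sphere)" by blast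
next
  assume "bilinear T \<and> bdd_above ((\<lambda>(x, y). norm (T x y)) ` prod_sphere)"
  then obtain M where bil: "bilinear T" and M: "\<And>x y. (x, y) \<in> prod_sphere \<Longrightarrow> norm (T x y) \<le> M"
    unfolding bdd_above_def by fastforce
  have "norm (T x y) \<le> norm x * norm y * M" for x y
  proof (cases "x = 0 \<or> y = 0")
    case True
    then show ?thesis using bil by (auto simp: bilinear_lzero bilinear_rzero)
  next
    case False
    then have "norm (T (x /\<^sub>R norm x) (y /\<^sub>R norm y)) \<le> M"
      by (intro M) (simp add: prod_sphere_def)
    with False show ?thesis
      by (simp add: bilinear_lmul[OF bil] bilinear_rmul[OF bil] field_simps)
  qed
  then show "bounded_bilinear T"
    by (intro bounded_bilinear.intro exI[of _ M])
       (auto simp: bilinear_ladd[OF bil] bilinear_radd[OF bil] bilinear_lmul[OF bil]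
          bilinear_rmul[OF bil])
qed

text \<open>\<open>H\<close> is a closed real hyperplane through \<open>u\<close> that has \<open>C\<close> on one side.\<close>

definition supporting_hyperplane_at ::
    "'a::real_normed_vector set \<Rightarrow> 'a \<Rightarrow> 'a set \<Rightarrow> bool" where
  "supporting_hyperplane_at C u H \<longleftrightarrow>
    (\<exists>f c. bounded_linear f \<and> f \<noteq> (\<lambda>_. 0) \<and> H = {x. f x = (c::real)} \<and> u \<in> H \<and> (\<forall>x\<in>C. f x \<le> c))"

definition smooth_space :: "'a::real_normed_vector itself \<Rightarrow> bool" where
  "smooth_space _ \<longleftrightarrow> (\<forall>u::'a. norm u = 1 \<longrightarrow> (\<exists>!H. supporting_hyperplane_at (cball 0 1) u H))"

text \<open>
  The library function \<^const>\<open>dim\<close> is \<open>0\<close> on infinite-dimensional spaces, so it cannot be used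
  here: the cardinality of a Hamel basis is compared with \<open>1\<close>, infinite bases being allowed.
\<close>

definition dim_gt_one :: "'a::real_vector itself \<Rightarrow> bool" where
  "dim_gt_one _ \<longleftrightarrow>
    (\<exists>B::'a set. independent B \<and> span B = UNIV \<and> (infinite B \<or> 1 < card B))"

definition semi_inner_product :: "('a::real_vector \<Rightarrow> 'a \<Rightarrow> real) \<Rightarrow> bool" where
  "semi_inner_product s \<longleftrightarrow>
    (\<forall>\<alpha> \<beta> x y z. s (\<alpha> *\<^sub>R x + \<beta> *\<^sub>R y) z = \<alpha> * s x z + \<beta> * s y z) \<and>
    (\<forall>x. x \<noteq> 0 \<longrightarrow> s x x > 0) \<and>
    (\<forall>x y. \<bar>s x y\<bar>\<^sup>2 \<le> s x x * s y y) \<and>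
    (\<forall>\<alpha> x y. s x (\<alpha> *\<^sub>R y) = \<alpha> * s x y)"

definition compatible_sip :: "('a::real_normed_vector \<Rightarrow> 'a \<Rightarrow> real) \<Rightarrow> bool" where
  "compatible_sip s \<longleftrightarrow> semi_inner_product s \<and> (\<forall>x. s x x = (norm x)\<^sup>2)"

end

theory Submission
  imports Defs
begin

text \<open>
  If \<open>T\<close> attains its norm \<open>N > 0\<close> at \<open>(x\<^sub>0, y\<^sub>0)\<close>, then
  \<open>N \<le> N \<parallel>x\<^sub>0\<parallel> \<parallel>y\<^sub>0\<parallel>\<close> forces both norms to be 1, and
  \<open>x \<mapsto> [T(x, y\<^sub>0), T(x\<^sub>0, y\<^sub>0)] / N\<^sup>2\<close> is a norm-one functional that takes the value 1 at
  \<open>x\<^sub>0\<close>. So is \<open>x \<mapsto> [x, x\<^sub>0]\<close>, and by smoothness the two agree; the second variable is symmetric.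
  Conversely, condition (ii) at \<open>(x, y) = (x\<^sub>0, 0)\<close> reads \<open>\<parallel>T(x\<^sub>0, y\<^sub>0)\<parallel>\<^sup>2 = N\<^sup>2\<close>.
\<close>

text \<open>For such a functional \<open>h\<close> the level set \<open>{x. h x = 1}\<close>
  supports the unit ball at \<open>u\<close>. Smoothness makes the level sets of \<open>f\<close>
  and \<open>g\<close> equal, and a linear functional is determined by its level set at 1.\<close>

lemma smooth_space_support_functional_unique:
  fixes f g :: "'a::real_normed_vector \<Rightarrow> real"
  assumes smooth: "smooth_space TYPE('a)" and u: "norm u = 1"
    and f: "linear f" "f u = 1" "\<And>x. \<bar>f x\<bar> \<le> norm x"
    and g: "linear g" "g u = 1" "\<And>x. \<bar>g x\<bar> \<le> norm x"
  shows "f = g"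
proof -
  have supp: "supporting_hyperplane_at (cball 0 1) u {x. h x = 1}"
    if h: "linear h" "h u = 1" "\<And>x. \<bar>h x\<bar> \<le> norm x" for h :: "'a \<Rightarrow> real"
    unfolding supporting_hyperplane_at_def
  proof (intro exI conjI ballI)
    show "bounded_linear h"
      using h by (auto intro!: bounded_linear_intro[where K = 1] simp: linear_add linear_scale)
    show "h \<noteq> (\<lambda>_. 0)" using h(2) by auto
    show "h x \<le> 1" if "x \<in> cball 0 1" for x
      using h(3)[of x] that by simp
  qed (use h(2) in simp_all)
  have level: "{x. f x = 1} = {x. g x = 1}"
    using smooth u supp[OF f] supp[OF g] unfolding smooth_space_def by blast
  show "f = g"
  proof
    fix x
    \<comment> \<open>If \<open>g x\<close> is nonzero, rescaling moves \<open>x\<close> into the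
      common level set; a vector in the kernel of \<open>g\<close> is moved there by adding
      \<open>u\<close>.\<close>
    show "f x = g x"
    proof (cases "g x = 0")
      case True
      then have "g (x + u) = 1" by (simp add: linear_add[OF g(1)] g(2))
      with level have "f (x + u) = 1" by blast
      with True show ?thesis by (simp add: linear_add[OF f(1)] f(2))
    next
      case False
      then have "g (x /\<^sub>R g x) = 1" by (simp add: linear_scale[OF g(1)])
      with level have "f (x /\<^sub>R g x) = 1" by blast
      with False show ?thesis by (simp add: linear_scale[OF f(1)] field_simps)
    qed
  qed
qed

lemma compatible_sip_self: "compatible_sip s \<Longrightarrow> s x x = (norm x)\<^sup>2"
  by (simp add: compatible_sip_def)

lemma compatible_sip_linear_left:
  assumes "compatible_sip s"
  shows "linear (\<lambda>x. s x z)"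
proof -
  have lin: "s (\<alpha> *\<^sub>R x + \<beta> *\<^sub>R y) z = \<alpha> * s x z + \<beta> * s y z" for \<alpha> \<beta> x y
    using assms by (simp add: compatible_sip_def semi_inner_product_def)
  show ?thesis
  proof (rule linearI)
    show "s (x + y) z = s x z + s y z" for x y using lin[of 1 x 1 y] by simp
    show "s (c *\<^sub>R x) z = c *\<^sub>R s x z" for c x using lin[of c x 0 0] by simp
  qed
qed

lemma compatible_sip_abs_le:
  assumes "compatible_sip s"
  shows "\<bar>s x y\<bar> \<le> norm x * norm y"
proof -
  have "\<bar>s x y\<bar>\<^sup>2 \<le> s x x * s y y"
    using assms unfolding compatible_sip_def semi_inner_product_def by blast
  also have "\<dots> = (norm x * norm y)\<^sup>2"
    by (simp add: compatible_sip_self[OF assms] power_mult_distrib)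
  finally show ?thesis by (rule power2_le_imp_le) simp
qed

text \<open>For \<open>N > 0\<close>, both sides divided by \<open>N\<^sup>2\<close> are support
  functionals of the unit ball at \<open>u\<close>, hence equal by smoothness. The lemma is meant
  for the two partial maps of \<open>T\<close>.\<close>

lemma sip_norm_attaining_linear:
  fixes A :: "'a::real_normed_vector \<Rightarrow> 'b::real_normed_vector"
  assumes smooth: "smooth_space TYPE('a)"
    and s: "compatible_sip s" and t: "compatible_sip t"
    and A: "linear A" "\<And>x. norm (A x) \<le> N * norm x"
    and u: "norm u = 1" "norm (A u) = N"
  shows "t (A x) (A u) = N\<^sup>2 * s x u"
proof (cases "N = 0")
  case True
  \<comment> \<open>Here \<open>A u = 0\<close>, so Cauchy-Schwarz makes the left side vanish
    too.\<close>
  then show ?thesis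
    using compatible_sip_abs_le[OF t, of "A x" "A u"] u by simp
next
  case False
  then have N: "N > 0" using u(2) norm_ge_zero[of "A u"] by linarith
  have "(\<lambda>x. t (A x) (A u) / N\<^sup>2) = (\<lambda>x. s x u)"
  proof (rule smooth_space_support_functional_unique[OF smooth u(1)])
    show "linear (\<lambda>x. t (A x) (A u) / N\<^sup>2)"
      using linear_compose[OF A(1) compatible_sip_linear_left[OF t, of "A u"]]
      by (auto intro!: linearI simp: linear_iff o_def add_divide_distrib)
    show "t (A u) (A u) / N\<^sup>2 = 1"
      using N u by (simp add: compatible_sip_self[OF t])
    show "\<bar>t (A x) (A u) / N\<^sup>2\<bar> \<le> norm x" for x
    proof -
      \<comment> \<open>Cauchy-Schwarz: \<open>A u\<close> and \<open>A x\<close> contribute one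
        factor \<open>N\<close> each, which cancels the denominator.\<close>
      have "\<bar>t (A x) (A u)\<bar> \<le> norm (A x) * N"
        using compatible_sip_abs_le[OF t, of "A x" "A u"] u by simp
      also have "\<dots> \<le> N * norm x * N"
        using A(2)[of x] N by (intro mult_right_mono) auto
      finally show ?thesis
        using N by (simp add: divide_le_eq power2_eq_square ac_simps)
    qed
    show "linear (\<lambda>x. s x u)" by (rule compatible_sip_linear_left[OF s])
    show "s u u = 1" by (simp add: compatible_sip_self[OF s] u)
    show "\<bar>s x u\<bar> \<le> norm x" for x
      using compatible_sip_abs_le[OF s, of x u] u by simp
  qed
  from fun_cong[OF this, of x] N show ?thesis by (simp add: field_simps)
qed

lemma norm_le_bilinear_norm_prod_sphere:
  assumes "bounded_bilinear T" "(x, y) \<in> prod_sphere"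
  shows "norm (T x y) \<le> bilinear_norm T"
proof -
  have "bdd_above ((\<lambda>(x, y). norm (T x y)) ` prod_sphere)"
    using iffD1[OF bounded_bilinear_iff_bdd_above_prod_sphere assms(1)] by (rule conjunct2)
  from cSUP_upper[OF assms(2) this] show ?thesis by (simp add: bilinear_norm_def)
qed

text \<open>Bilinearity allows nonzero \<open>x\<close> and \<open>y\<close> to be normalised
  separately, and a pair of unit vectors lies on the sphere of the maximum norm.\<close>

lemma norm_le_bilinear_norm:
  assumes T: "bounded_bilinear T"
  shows "norm (T x y) \<le> bilinear_norm T * norm x * norm y"
proof (cases "x = 0 \<or> y = 0")
  case True
  then show ?thesis
    by (auto simp: bounded_bilinear.zero_left[OF T] bounded_bilinear.zero_right[OF T])
next
  case False
  then have "norm (T (x /\<^sub>R norm x) (y /\<^sub>R norm y)) \<le> bilinear_norm T"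
    by (intro norm_le_bilinear_norm_prod_sphere[OF T]) (simp add: prod_sphere_def)
  with False show ?thesis
    by (simp add: bounded_bilinear.scaleR_left[OF T] bounded_bilinear.scaleR_right[OF T]
        field_simps)
qed

theorem theorem2p7:
  fixes T :: "'x::banach \<Rightarrow> 'y::banach \<Rightarrow> 'z::banach"
    and sipX :: "'x \<Rightarrow> 'x \<Rightarrow> real"
    and sipY :: "'y \<Rightarrow> 'y \<Rightarrow> real"
    and sipZ :: "'z \<Rightarrow> 'z \<Rightarrow> real"
    and x0 :: 'x and y0 :: 'y
  assumes "smooth_space TYPE('x)" and "smooth_space TYPE('y)" and "smooth_space TYPE('z)"
    and "dim_gt_one TYPE('x)" and "dim_gt_one TYPE('y)" and "dim_gt_one TYPE('z)"
    and "bounded_bilinear T"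
    and "T \<noteq> (\<lambda>_ _. 0)"
    and "compatible_sip sipX" and "compatible_sip sipY" and "compatible_sip sipZ"
    and "(x0, y0) \<in> prod_sphere"
  shows "(x0, y0) \<in> norm_attainment_set T \<longleftrightarrow>
    (norm x0 = 1 \<and> norm y0 = 1) \<and>
    (\<forall>x y. sipZ (T x0 y + T x y0) (T x0 y0) =
      (bilinear_norm T)\<^sup>2 * (sipX x x0 + sipY y y0))"
proof -
  define N where "N = bilinear_norm T"
  note T = \<open>bounded_bilinear T\<close>
  note bound = norm_le_bilinear_norm[OF T, folded N_def]
  have sphere: "max (norm x0) (norm y0) = 1"
    using \<open>(x0, y0) \<in> prod_sphere\<close> by (simp add: prod_sphere_def)
  have "N \<ge> 0"
    using norm_le_bilinear_norm_prod_sphere[OF T \<open>(x0, y0) \<in> prod_sphere\<close>, folded N_def]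
      norm_ge_zero[of "T x0 y0"] by linarith
  have attain: "(x0, y0) \<in> norm_attainment_set T \<longleftrightarrow> norm (T x0 y0) = N"
    using \<open>(x0, y0) \<in> prod_sphere\<close> by (simp add: norm_attainment_set_def N_def)
  show ?thesis
    unfolding attain N_def[symmetric]
  proof (intro iffI conjI allI)
    assume eq: "norm (T x0 y0) = N"
    \<comment> \<open>The zero operator attains its norm on the whole sphere, even at points with
      \<open>y0 = 0\<close>, so condition (i) rests on \<open>T\<close> being nonzero.\<close>
    have "N \<noteq> 0"
    proof
      assume "N = 0"
      with bound have "T x y = 0" for x y by simp
      with \<open>T \<noteq> (\<lambda>_ _. 0)\<close> show False by blast
    qed
    with \<open>N \<ge> 0\<close> have "1 \<le> norm x0 * norm y0"
      using bound[of x0 y0] eq by (simp add: mult.assoc)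
    moreover have "norm x0 \<le> 1" "norm y0 \<le> 1" using sphere by auto
    \<comment> \<open>The product is at least 1 and bounded by each factor, so neither factor is
      below 1.\<close>
    moreover have "norm x0 * norm y0 \<le> norm x0" "norm x0 * norm y0 \<le> norm y0"
      using \<open>norm x0 \<le> 1\<close> \<open>norm y0 \<le> 1\<close> by (simp_all add: mult_left_le mult_left_le_one_le)
    ultimately show x0: "norm x0 = 1" and y0: "norm y0 = 1" by linarith+
    fix x y
    \<comment> \<open>Since \<open>norm y0 = 1\<close>, the partial map at \<open>y0\<close> is
      bounded by \<open>N\<close> and attains this bound at \<open>x0\<close>.\<close>
    have "sipZ (T x y0) (T x0 y0) = N\<^sup>2 * sipX x x0"
    proof (rule sip_norm_attaining_linear[where A = "\<lambda>x. T x y0"])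
      show "linear (\<lambda>x. T x y0)"
        by (rule bounded_linear.linear[OF bounded_bilinear.bounded_linear_left[OF T]])
      show "norm (T x y0) \<le> N * norm x" for x using bound[of x y0] y0 by simp
    qed (fact assms x0 eq)+
    moreover have "sipZ (T x0 y) (T x0 y0) = N\<^sup>2 * sipY y y0"
    proof (rule sip_norm_attaining_linear[where A = "T x0"])
      show "linear (T x0)"
        by (rule bounded_linear.linear[OF bounded_bilinear.bounded_linear_right[OF T]])
      show "norm (T x0 y) \<le> N * norm y" for y using bound[of x0 y] x0 by simp
    qed (fact assms y0 eq)+
    ultimately show "sipZ (T x0 y + T x y0) (T x0 y0) = N\<^sup>2 * (sipX x x0 + sipY y y0)"
      using linear_add[OF compatible_sip_linear_left[OF \<open>compatible_sip sipZ\<close>]]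
      by (simp add: algebra_simps)
  next
    assume R: "(norm x0 = 1 \<and> norm y0 = 1) \<and>
      (\<forall>x y. sipZ (T x0 y + T x y0) (T x0 y0) = N\<^sup>2 * (sipX x x0 + sipY y y0))"
    \<comment> \<open>With \<open>y = 0\<close> the terms \<open>T x0 0\<close> and
      \<open>sipY 0 y0\<close> vanish, and \<open>sipX x0 x0 = 1\<close> by (i).\<close>
    then have "sipZ (T x0 0 + T x0 y0) (T x0 y0) = N\<^sup>2 * (sipX x0 x0 + sipY 0 y0)" by blast
    with R have "(norm (T x0 y0))\<^sup>2 = N\<^sup>2"
      by (simp add: bounded_bilinear.zero_right[OF T]
          linear_0[OF compatible_sip_linear_left[OF \<open>compatible_sip sipY\<close>]]
          compatible_sip_self[OF \<open>compatible_sip sipX\<close>] compatible_sip_self[OF \<open>compatible_sip sipZ\<close>])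
    with \<open>N \<ge> 0\<close> show "norm (T x0 y0) = N" by (simp add: power2_eq_iff_nonneg)
  qed
qed

end
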